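(* Let $d\ge 2$ and let $X=\mathsf{X}_{\mathcal{F}}$ be a Markov tree-shift on the $d$-ary tree over a finite alphabet $\mathcal{A}$ such that every symbol of $\mathcal{A}$ is essential for $X$. Suppose $a\in\mathcal{A}$ is a saving symbol for $X$. Let $Y=\mathsf{X}_{\mathcal{F}'}$ be a proper subspace of $X$, where $\mathcal{F}'$ is a set of $2$-blocks such that (1) $\mathcal{F}\subsetneq\mathcal{F}'$ and $\mathcal{F}'\setminus\mathcal{F}$ consists of exactly one pattern; and (2) for every $\mathcal{A}'\subsetneq\mathcal{A}$, $Y$ is not a tree-shift of finite type over $\mathcal{A}'$, i.e. every symbol of $\mathcal{A}$ occurs in some tree of $Y$. Then $h(Y)<h(X)$ if and only if $a$ is an inessential symbol for $Y$.
   Context: Let $\Sigma=\{0,\ldots,d-1\}$ and $\Sigma^{*}$ the set of finite words over $\Sigma$ (including the empty word). An infinite tree over $\mathcal{A}$ is a function $t:\Sigma^{*}\to\mathcal{A}$. An $n$-block is a function from $\bigcup_{j=0}^{n-1}\Sigma^j$ to $\mathcal{A}$; a $2$-block is written $(\alpha,\alpha_1,\ldots,\alpha_d)$ (root label, then labels of the $d$ children). A block $u$ occurs in $t$ if for some $x\in\Sigma^{*}$, $u_y=t_{xy}$ for all $y$ in the support of $u$. A Markov tree-shift is $\mathsf{X}_{\mathcal{F}}$, the set of all infinite trees in which no element of $\mathcal{F}$ occurs, where $\mathcal{F}$ is a set of $2$-blocks. $B_n(X)$ is the set of $n$-blocks occurring in trees of $X$, and the entropy is $h(X)=\lim_{n\to\infty}\frac{\ln\ln|B_n(X)|}{n}$.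 Write $\mathcal{A}=\{a^{(1)},\ldots,a^{(k)}\}$. To $\mathsf{X}_{\mathcal{F}}$ is associated the system of nonlinear recursive equations $$a_n^{(i)}=\sum_{(a^{(i)},a^{(i_1)},\ldots,a^{(i_d)})\notin\mathcal{F}}\ \prod_{j=1}^d a_{n-1}^{(i_j)}\quad(n\ge 2),\qquad a_1^{(i)}=\#\{\text{2-blocks with root } a^{(i)}\text{ not in }\mathcal{F}\}\ge 1,$$ and similarly for $\mathcal{F}'$. A symbol $a^{(i)}$ is essential for the tree-shift if $a_m^{(i)}\ge 2$ for some $m\in\mathbb{N}$, and inessential otherwise. A symbol $a\in\mathcal{A}$ is a saving symbol for $\mathsf{X}_{\mathcal{F}}$ if for each $2$-block $(\alpha,\alpha_1,\ldots,\alpha_d)\notin\mathcal{F}$ with $\alpha\ne a$ there exists $1\le i\le d$ with $\alpha_i=a$. *)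

theory Defs
  imports Complex_Main "HOL-Library.Cardinality"
begin

text \<open>
  The index set \<open>{0,\<dots>,d-1}\<close> of the children is the finite type \<^typ>\<open>'d\<close>, so that
  \<open>d = CARD('d)\<close> and finite words are elements of \<^typ>\<open>'d list\<close>; the finite alphabet is the
  finite type \<^typ>\<open>'a\<close>.
\<close>

type_synonym ('d, 'a) inf_tree = "'d list \<Rightarrow> 'a"

text \<open>A block is a partial labelling of words; its support is its domain.\<close>

type_synonym ('d, 'a) block = "'d list \<Rightarrow> 'a option"

definition n_blocks :: "nat \<Rightarrow> ('d, 'a) block set" where
  "n_blocks n = {u. dom u = {x. length x < n}}"

text \<open>The 2-block \<open>(\<alpha>, \<alpha>\<^sub>1, \<dots>, \<alpha>\<^sub>d)\<close>, with the labels of the children given as a function.\<close>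

definition two_block :: "'a \<Rightarrow> ('d \<Rightarrow> 'a) \<Rightarrow> ('d, 'a) block" where
  "two_block \<alpha> \<alpha>s = (\<lambda>y. case y of [] \<Rightarrow> Some \<alpha> | [i] \<Rightarrow> Some (\<alpha>s i) | _ \<Rightarrow> None)"

definition occurs_in :: "('d, 'a) block \<Rightarrow> ('d, 'a) inf_tree \<Rightarrow> bool" where
  "occurs_in u t \<longleftrightarrow> (\<exists>x. \<forall>y\<in>dom u. u y = Some (t (x @ y)))"

definition tree_shift :: "('d, 'a) block set \<Rightarrow> ('d, 'a) inf_tree set" where
  "tree_shift F = {t. \<forall>u\<in>F. \<not> occurs_in u t}"

definition occurring_blocks :: "nat \<Rightarrow> ('d, 'a) inf_tree set \<Rightarrow> ('d, 'a) block set" where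
  "occurring_blocks n X = {u \<in> n_blocks n. \<exists>t\<in>X. occurs_in u t}"

text \<open>
  If at least two symbols occur in \<open>X\<close>, then there are at least two \<open>n\<close>-blocks for every
  \<open>n \<ge> 1\<close>, and the convention \<open>ln 0 = 0\<close> of the library plays no role in this limit.
\<close>

definition entropy :: "('d::finite, 'a::finite) inf_tree set \<Rightarrow> real" where
  "entropy X = lim (\<lambda>n. ln (ln (real (card (occurring_blocks n X)))) / real n)"

text \<open>
  The solution of the system of nonlinear recursive equations associated with \<open>F\<close>. The system
  starts at index 1; the value at index 0 is a dummy.
\<close>

fun rec_count :: "('d::finite, 'a::finite) block set \<Rightarrow> nat \<Rightarrow> 'a \<Rightarrow> nat" where
  "rec_count F 0 s = 1"
| "rec_count F (Suc 0) s = card {\<alpha>s. two_block s \<alpha>s \<notin> F}"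
| "rec_count F (Suc (Suc n)) s =
     (\<Sum>\<alpha>s\<in>{\<alpha>s. two_block s \<alpha>s \<notin> F}. \<Prod>j\<in>UNIV. rec_count F (Suc n) (\<alpha>s j))"

definition essential :: "('d::finite, 'a::finite) block set \<Rightarrow> 'a \<Rightarrow> bool" where
  "essential F s \<longleftrightarrow> (\<exists>m\<ge>1. rec_count F m s \<ge> 2)"

definition inessential :: "('d::finite, 'a::finite) block set \<Rightarrow> 'a \<Rightarrow> bool" where
  "inessential F s \<longleftrightarrow> \<not> essential F s"

definition saving_symbol :: "('d, 'a) block set \<Rightarrow> 'a \<Rightarrow> bool" where
  "saving_symbol F a \<longleftrightarrow>
     (\<forall>\<alpha> \<alpha>s. two_block \<alpha> \<alpha>s \<notin> F \<and> \<alpha> \<noteq> a \<longrightarrow> (\<exists>i. \<alpha>s i = a))"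

end

theory Submission
  imports Defs "HOL-Library.FuncSet"
begin

text \<open>
  If every symbol is essential, then there is a level beyond which every node contributes at least
  a factor 2, and since each of the \<open>d ^ n\<close> nodes of level \<open>n\<close> is essential, the entropy is
  \<open>ln d\<close>. This applies to \<open>X\<close>, and also to \<open>Y\<close> if \<open>a\<close> is essential for \<open>Y\<close>, because a symbol with an
  essential child is essential. If \<open>a\<close> is inessential for \<open>Y\<close>, then an essential node of \<open>Y\<close> has at
  most \<open>d - 1\<close> essential children, so that the entropy is at most \<open>ln (d - 1)\<close>.

  The existence of the limit defining the entropy is part of the claim. In general, the number of
  blocks is, up to factors that do not matter after taking two logarithms, the exponential of the
  largest possible number of essential nodes on one level; this number is submultiplicative, so that
  Fekete's lemma applies.
\<close>

section \<open>Limits of subadditive sequences\<close>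

text \<open>This is Fekete's lemma. The second conclusion matters as much as the first: it later
  bounds the entropy by the single quotient at \<open>n = 1\<close>.\<close>

lemma subadditive_limit:
  fixes p :: "nat \<Rightarrow> real"
  assumes sub: "\<And>m n. p (m + n) \<le> p m + p n" and nonneg: "\<And>n. 0 \<le> p n"
  obtains l where "(\<lambda>n. p n / real n) \<longlonglongrightarrow> l" "\<And>n. n \<ge> 1 \<Longrightarrow> l \<le> p n / real n"
proof -
  define l where "l = (INF n\<in>{1..}. p n / real n)"
  have bdd: "bdd_below ((\<lambda>n. p n / real n) ` {1..})"
    using nonneg by (intro bdd_belowI[of _ 0]) auto
  have lower: "l \<le> p n / real n" if "n \<ge> 1" for n
    unfolding l_def using bdd that by (intro cINF_lower) auto
  \<comment> \<open>Division of an index by \<open>N\<close> leaves a remainder, and subadditivity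
    peels off \<open>q\<close> pieces of length \<open>N\<close>.\<close>
  have mult: "p (q * N + r) \<le> real q * p N + p r" for q N r
  proof (induction q)
    case (Suc q)
    have "p (Suc q * N + r) = p (N + (q * N + r))" by (simp add: algebra_simps)
    also have "\<dots> \<le> p N + p (q * N + r)" by (rule sub)
    finally show ?case using Suc by (simp add: algebra_simps)
  qed simp
  have "(\<lambda>n. p n / real n) \<longlonglongrightarrow> l"
  proof (rule LIMSEQ_I)
    fix e :: real assume e: "0 < e"
    then have "(INF n\<in>{1..}. p n / real n) < l + e / 2" by (simp add: l_def)
    then obtain N where N: "N \<ge> 1" "p N / real N < l + e / 2"
      using bdd by (subst (asm) cINF_less_iff) auto
    \<comment> \<open>A bound for all remainders at once; after division by \<open>n\<close> it
      vanishes in the limit.\<close>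
    define C where "C = (\<Sum>r<N. p r)"
    have C: "p r \<le> C" if "r < N" for r
      unfolding C_def using that nonneg by (intro member_le_sum) auto
    have bound: "p n / real n \<le> p N / real N + C / real n" if "n \<ge> 1" for n
    proof -
      have "p n \<le> real (n div N) * p N + p (n mod N)"
        using mult[of "n div N" N "n mod N"] by simp
      also have "\<dots> \<le> real (n div N) * p N + C" using C N by simp
      also have "\<dots> \<le> (real n / real N) * p N + C"
        using mult_right_mono[OF of_nat_div_le_of_nat nonneg, of n N N] by simp
      finally have "p n / real n \<le> ((real n / real N) * p N + C) / real n"
        by (simp add: divide_right_mono)
      also have "\<dots> = p N / real N + C / real n" using that by (simp add: add_divide_distrib)
      finally show ?thesis .
    qed
    have "(\<lambda>n. C / real n) \<longlonglongrightarrow> 0" by (rule lim_const_over_n)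
    then have "eventually (\<lambda>n. C / real n < e / 2) sequentially"
      by (rule order_tendstoD) (use e in simp)
    then obtain M where M: "\<And>n. n \<ge> M \<Longrightarrow> C / real n < e / 2"
      by (auto simp: eventually_sequentially)
    have "norm (p n / real n - l) < e" if "n \<ge> max 1 M" for n
    proof -
      have "n \<ge> 1" "n \<ge> M" using that by auto
      then have "l \<le> p n / real n" "p n / real n < l + e"
        using lower[of n] bound[of n] M[of n] N(2) by linarith+
      then show ?thesis by simp
    qed
    then show "\<exists>M. \<forall>n\<ge>M. norm (p n / real n - l) < e" by blast
  qed
  then show ?thesis using lower that by blast
qed

definition succs :: "('d, 'a) block set \<Rightarrow> 'a \<Rightarrow> ('d \<Rightarrow> 'a) set" where
  "succs F s = {\<alpha>s. two_block s \<alpha>s \<notin> F}"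

text \<open>The dummy value 1 at index 0 is chosen well: a sum of empty choices, each worth 1,
  counts the allowed child labellings, so one recursion covers index 1 too.\<close>

lemma rec_count_Suc:
  "rec_count F (Suc n) s = (\<Sum>\<alpha>s\<in>succs F s. \<Prod>j\<in>UNIV. rec_count F n (\<alpha>s j))"
  by (cases n) (simp_all add: succs_def)

section \<open>Blocks of a Markov tree-shift\<close>

lemma n_block_2_eq_two_block:
  assumes "u \<in> n_blocks 2"
  shows "\<exists>\<alpha> \<alpha>s. u = two_block \<alpha> \<alpha>s"
proof -
  have d: "dom u = {x. length x < 2}" using assms by (simp add: n_blocks_def)
  have "u = two_block (the (u [])) (\<lambda>i. the (u [i]))"
  proof
    fix y
    show "u y = two_block (the (u [])) (\<lambda>i. the (u [i])) y"
    proof (cases "length y < 2")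
      case True
      then have "y \<in> dom u" by (simp add: d)
      then show ?thesis using True
        by (auto simp: two_block_def split: list.splits)
    next
      case False
      then have "y \<notin> dom u" by (simp add: d)
      then show ?thesis using False
        by (auto simp: two_block_def domIff split: list.splits)
    qed
  qed
  then show ?thesis by blast
qed

lemma occurs_in_two_block:
  "occurs_in (two_block \<alpha> \<alpha>s) t \<longleftrightarrow> (\<exists>x. t x = \<alpha> \<and> (\<forall>j. t (x @ [j]) = \<alpha>s j))"
proof -
  \<comment> \<open>The rule \<open>remdups_adj.cases\<close> serves to split words into those of
    length 0, 1 and at least 2.\<close>
  have "y \<in> dom (two_block \<alpha> \<alpha>s) \<longleftrightarrow> y \<in> insert [] (range (\<lambda>j. [j]))" for y
    by (cases y rule: remdups_adj.cases) (auto simp: two_block_def)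
  then have d: "dom (two_block \<alpha> \<alpha>s) = insert [] (range (\<lambda>j. [j]))" by blast
  show ?thesis unfolding occurs_in_def d by (auto simp: two_block_def)
qed

text \<open>Every forbidden block is a 2-block, so its occurrence at \<open>x\<close> concerns only
  \<open>x\<close> and its children.\<close>

lemma tree_shift_iff:
  assumes "F \<subseteq> n_blocks 2"
  shows "t \<in> tree_shift F \<longleftrightarrow> (\<forall>x. (\<lambda>j. t (x @ [j])) \<in> succs F (t x))"
proof
  assume t: "t \<in> tree_shift F"
  show "\<forall>x. (\<lambda>j. t (x @ [j])) \<in> succs F (t x)"
  proof
    fix x
    have "occurs_in (two_block (t x) (\<lambda>j. t (x @ [j]))) t" by (auto simp: occurs_in_two_block)
    then show "(\<lambda>j. t (x @ [j])) \<in> succs F (t x)"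
      using t by (auto simp: tree_shift_def succs_def)
  qed
next
  assume t: "\<forall>x. (\<lambda>j. t (x @ [j])) \<in> succs F (t x)"
  show "t \<in> tree_shift F" unfolding tree_shift_def
  proof (clarify)
    fix u assume u: "u \<in> F" "occurs_in u t"
    then obtain \<alpha> \<alpha>s where ua: "u = two_block \<alpha> \<alpha>s" using n_block_2_eq_two_block assms by blast
    then obtain x where "t x = \<alpha>" "\<And>j. t (x @ [j]) = \<alpha>s j"
      using u by (auto simp: occurs_in_two_block)
    then have "u = two_block (t x) (\<lambda>j. t (x @ [j]))" using ua by simp
    then show False using t u by (auto simp: succs_def)
  qed
qed

lemma subtree_in_tree_shift:
  assumes "F \<subseteq> n_blocks 2" and "t \<in> tree_shift F"
  shows "(\<lambda>y. t (x @ y)) \<in> tree_shift F"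
  unfolding tree_shift_iff[OF assms(1)]
proof
  fix y
  have "(\<lambda>j. t ((x @ y) @ [j])) \<in> succs F (t (x @ y))"
    using assms(2) unfolding tree_shift_iff[OF assms(1)] by blast
  then show "(\<lambda>j. t (x @ y @ [j])) \<in> succs F (t (x @ y))" by simp
qed

lemma tree_shift_iff_subtrees:
  assumes "F \<subseteq> n_blocks 2"
  shows "t \<in> tree_shift F \<longleftrightarrow>
    (\<lambda>j. t [j]) \<in> succs F (t []) \<and> (\<forall>j. (\<lambda>y. t (j # y)) \<in> tree_shift F)"
proof -
  have all_list: "(\<forall>x. P x) \<longleftrightarrow> P [] \<and> (\<forall>j y. P (j # y))" for P :: "'a list \<Rightarrow> bool"
    by (metis list.exhaust)
  show ?thesis unfolding tree_shift_iff[OF assms]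
    by (subst all_list) simp
qed

definition top_block :: "nat \<Rightarrow> ('d, 'a) inf_tree \<Rightarrow> ('d, 'a) block" where
  "top_block n t = (\<lambda>y. if length y < n then Some (t y) else None)"

definition rooted_blocks :: "('d, 'a) block set \<Rightarrow> nat \<Rightarrow> 'a \<Rightarrow> ('d, 'a) block set" where
  "rooted_blocks F n s = top_block n ` {t \<in> tree_shift F. t [] = s}"

text \<open>Both tree-shifts of the theorem are instances. That every symbol occurs makes every
  symbol the root of some tree, hence gives it an allowed child labelling and keeps all counts
  positive.\<close>

locale markov_tree_shift =
  fixes F :: "('d::finite, 'a::finite) block set"
  assumes two_blocks: "F \<subseteq> n_blocks 2"
    and symbol_occurs: "\<exists>t\<in>tree_shift F. s \<in> range t"
begin

lemma tree_with_root: "\<exists>t\<in>tree_shift F. t [] = s"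
proof -
  obtain t x where t: "t \<in> tree_shift F" "t x = s" using symbol_occurs[of s] by blast
  have "(\<lambda>y. t (x @ y)) \<in> tree_shift F" using two_blocks t(1) by (rule subtree_in_tree_shift)
  then show ?thesis by (rule bexI[rotated]) (simp add: t(2))
qed

lemma succs_nonempty: "succs F s \<noteq> {}"
proof -
  obtain t where t: "t \<in> tree_shift F" "t [] = s" using tree_with_root by blast
  then have "(\<lambda>j. t [j]) \<in> succs F (t [])"
    using tree_shift_iff_subtrees[OF two_blocks, of t] by blast
  then show ?thesis using t(2) by auto
qed

text \<open>A block occurring at \<open>x\<close> sits at the root of the subtree at
  \<open>x\<close>, which again belongs to the tree-shift.\<close>

lemma occurring_blocks_eq: "occurring_blocks n (tree_shift F) = (\<Union>s. rooted_blocks F n s)"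
proof (intro set_eqI iffI)
  fix u assume u: "u \<in> occurring_blocks n (tree_shift F)"
  then obtain t x where t: "t \<in> tree_shift F" "\<forall>y\<in>dom u. u y = Some (t (x @ y))"
    unfolding occurring_blocks_def occurs_in_def by blast
  have d: "dom u = {x. length x < n}"
    using u by (simp add: occurring_blocks_def n_blocks_def)
  have "(\<lambda>y. t (x @ y)) \<in> tree_shift F"
    using two_blocks t(1) by (rule subtree_in_tree_shift)
  moreover have "u = top_block n (\<lambda>y. t (x @ y))"
  proof
    fix y
    show "u y = top_block n (\<lambda>y. t (x @ y)) y"
      using t(2) d by (cases "y \<in> dom u") (auto simp: top_block_def)
  qed
  ultimately show "u \<in> (\<Union>s. rooted_blocks F n s)" by (auto simp: rooted_blocks_def)
next
  fix u assume "u \<in> (\<Union>s. rooted_blocks F n s)"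
  then obtain t where t: "t \<in> tree_shift F" "u = top_block n t"
    by (auto simp: rooted_blocks_def)
  then have "\<forall>y\<in>dom u. u y = Some (t ([] @ y))" "dom u = {x. length x < n}"
    by (auto simp: top_block_def dom_def)
  then have "occurs_in u t" "u \<in> n_blocks n"
    unfolding occurs_in_def n_blocks_def by blast+
  then show "u \<in> occurring_blocks n (tree_shift F)" using t by (auto simp: occurring_blocks_def)
qed

text \<open>A block is cut below its root into one block per child. These have height at least 1, so
  they contain their own roots and the child labelling can be read off from them; this gives
  injectivity.\<close>

lemma rooted_blocks_Suc:
  fixes n s
  defines "join \<equiv> \<lambda>(\<alpha>s :: 'd \<Rightarrow> 'a, us :: 'd \<Rightarrow> ('d, 'a) block) y.
    case y of [] \<Rightarrow> Some s | j # z \<Rightarrow> us j z"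
  defines "D \<equiv> SIGMA \<alpha>s:succs F s. PiE UNIV (\<lambda>j. rooted_blocks F (Suc n) (\<alpha>s j))"
  shows "bij_betw join D (rooted_blocks F (Suc (Suc n)) s)"
  unfolding bij_betw_def
proof
  show "inj_on join D"
  proof (rule inj_onI)
    fix p q assume pq: "p \<in> D" "q \<in> D" "join p = join q"
    obtain \<alpha>s us \<beta>s vs where eq: "p = (\<alpha>s, us)" "q = (\<beta>s, vs)" by (metis surj_pair)
    have "us j z = vs j z" for j z
      using fun_cong[OF pq(3), of "j # z"] by (simp add: join_def eq)
    then have us: "us = vs" by blast
    have "us j \<in> rooted_blocks F (Suc n) (\<alpha>s j)" "vs j \<in> rooted_blocks F (Suc n) (\<beta>s j)" for j
      using pq(1,2) by (auto simp: D_def eq)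
    then have "us j [] = Some (\<alpha>s j)" "vs j [] = Some (\<beta>s j)" for j
      by (auto simp: rooted_blocks_def top_block_def dest!: meta_spec[of _ j])
    then have "\<alpha>s = \<beta>s" using us by (metis ext option.inject)
    with us eq show "p = q" by simp
  qed
  show "join ` D = rooted_blocks F (Suc (Suc n)) s"
  proof (intro set_eqI iffI)
    fix u assume "u \<in> join ` D"
    then obtain \<alpha>s us where u: "u = join (\<alpha>s, us)" "\<alpha>s \<in> succs F s"
      "\<And>j. us j \<in> rooted_blocks F (Suc n) (\<alpha>s j)"
      by (auto simp: D_def PiE_def)
    have "\<exists>t. t \<in> tree_shift F \<and> t [] = \<alpha>s j \<and> us j = top_block (Suc n) t" for j
      using u(3)[of j] by (auto simp: rooted_blocks_def)
    then obtain t where t: "\<And>j. t j \<in> tree_shift F" "\<And>j. t j [] = \<alpha>s j"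
      "\<And>j. us j = top_block (Suc n) (t j)" by metis
    \<comment> \<open>The child blocks are extended to trees, which may be glued below
      \<open>s\<close> independently of each other because only 2-blocks are forbidden.\<close>
    define t' where "t' = (\<lambda>y. case y of [] \<Rightarrow> s | j # z \<Rightarrow> t j z)"
    have "t' \<in> tree_shift F"
      using t u(2) by (subst tree_shift_iff_subtrees[OF two_blocks]) (simp add: t'_def)
    moreover have "u = top_block (Suc (Suc n)) t'"
      by (auto simp: u join_def t top_block_def t'_def fun_eq_iff split: list.splits)
    moreover have "t' [] = s" by (simp add: t'_def)
    ultimately show "u \<in> rooted_blocks F (Suc (Suc n)) s" by (auto simp: rooted_blocks_def)
  next
    fix u assume "u \<in> rooted_blocks F (Suc (Suc n)) s"
    then obtain t where t: "t \<in> tree_shift F" "t [] = s" "u = top_block (Suc (Suc n)) t"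
      by (auto simp: rooted_blocks_def)
    have "((\<lambda>j. t [j]), (\<lambda>j. top_block (Suc n) (\<lambda>y. t (j # y)))) \<in> D"
      using t(1,2) tree_shift_iff_subtrees[OF two_blocks, of t]
      by (auto simp: D_def rooted_blocks_def)
    moreover have "u = join ((\<lambda>j. t [j]), (\<lambda>j. top_block (Suc n) (\<lambda>y. t (j # y))))"
      using t by (auto simp: join_def top_block_def fun_eq_iff split: list.splits)
    ultimately show "u \<in> join ` D" by blast
  qed
qed

text \<open>The height exceeds the index of the recursion by one: index 0 with its value 1 stands
  for the block consisting of the root alone.\<close>

lemma card_rooted_blocks:
  "finite (rooted_blocks F (Suc n) s) \<and> card (rooted_blocks F (Suc n) s) = rec_count F n s"
proof (induction n arbitrary: s)
  case 0
  have "rooted_blocks F (Suc 0) s = {[[] \<mapsto> s]}"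
  proof -
    have "top_block (Suc 0) t = [[] \<mapsto> t []]" for t :: "('d, 'a) inf_tree"
      by (auto simp: top_block_def)
    then show ?thesis using tree_with_root[of s] by (auto simp: rooted_blocks_def)
  qed
  then show ?case by simp
next
  case (Suc n)
  let ?D = "SIGMA \<alpha>s:succs F s. PiE UNIV (\<lambda>j. rooted_blocks F (Suc n) (\<alpha>s j))"
  have "finite ?D" using Suc by (intro finite_SigmaI finite_PiE) auto
  moreover have "card ?D = rec_count F (Suc n) s"
    using Suc by (simp add: card_PiE finite_PiE rec_count_Suc)
  ultimately show ?case
    using bij_betw_finite[OF rooted_blocks_Suc] bij_betw_same_card[OF rooted_blocks_Suc] by metis
qed

lemma card_occurring_blocks:
  "card (occurring_blocks (Suc n) (tree_shift F)) = (\<Sum>s\<in>UNIV. rec_count F n s)"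
proof -
  have "card (\<Union>s\<in>UNIV. rooted_blocks F (Suc n) s) = (\<Sum>s\<in>UNIV. card (rooted_blocks F (Suc n) s))"
  proof (rule card_UN_disjoint)
    have "u [] = Some s" if "u \<in> rooted_blocks F (Suc n) s" for u s
      using that by (auto simp: rooted_blocks_def top_block_def)
    then show "\<forall>i\<in>UNIV. \<forall>j\<in>UNIV. i \<noteq> j \<longrightarrow>
      rooted_blocks F (Suc n) i \<inter> rooted_blocks F (Suc n) j = {}"
      by (metis disjoint_iff option.inject)
  qed (use card_rooted_blocks in auto)
  then show ?thesis by (simp add: occurring_blocks_eq card_rooted_blocks)
qed

end

section \<open>Growth of the number of essential labels\<close>

text \<open>
  The largest number of essential labels on a level of depth at most \<open>n\<close> below a node labelled
  \<open>s\<close>. Taking levels \<open>\<le> n\<close> instead of the level \<open>n\<close> makes it monotone even if essential labels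
  have only inessential children.
\<close>

fun weight :: "('d::finite, 'a::finite) block set \<Rightarrow> nat \<Rightarrow> 'a \<Rightarrow> nat" where
  "weight F 0 s = (if essential F s then 1 else 0)"
| "weight F (Suc n) s =
     max (weight F n s) (Max ((\<lambda>\<alpha>s. \<Sum>j\<in>UNIV. weight F n (\<alpha>s j)) ` succs F s))"

text \<open>The cutoff at 1 keeps the logarithm nonnegative even if no symbol is essential.\<close>

definition max_weight :: "('d::finite, 'a::finite) block set \<Rightarrow> nat \<Rightarrow> nat" where
  "max_weight F n = max 1 (Max (range (weight F n)))"

lemma max_weight_ge_1: "max_weight F n \<ge> 1"
  by (simp add: max_weight_def)

lemma weight_le_max_weight: "weight F n s \<le> max_weight F n"
  by (auto simp: max_weight_def intro!: max.coboundedI2 Max_ge)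

lemma max_weight_le: "\<lbrakk>1 \<le> c; \<And>s. weight F n s \<le> c\<rbrakk> \<Longrightarrow> max_weight F n \<le> c"
  by (auto simp: max_weight_def)

lemma max_weight_mono: "max_weight F n \<le> max_weight F (Suc n)"
proof (rule max_weight_le)
  fix s
  have "weight F n s \<le> weight F (Suc n) s" by simp
  then show "weight F n s \<le> max_weight F (Suc n)" using weight_le_max_weight order_trans by blast
qed (rule max_weight_ge_1)

lemma sum_weight_le_weight_Suc:
  "\<alpha>s \<in> succs F s \<Longrightarrow> (\<Sum>j\<in>UNIV. weight F n (\<alpha>s j)) \<le> weight F (Suc n) s"
  by (auto intro!: max.coboundedI2 Max_ge)

context markov_tree_shift
begin

lemma weight_Suc_cases:
  obtains "weight F (Suc n) s = weight F n s"
  | \<alpha>s where "\<alpha>s \<in> succs F s" "weight F (Suc n) s = (\<Sum>j\<in>UNIV. weight F n (\<alpha>s j))"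
proof -
  let ?A = "(\<lambda>\<alpha>s. \<Sum>j\<in>UNIV. weight F n (\<alpha>s j)) ` succs F s"
  have "Max ?A \<in> ?A" using succs_nonempty by (intro Max_in) auto
  then obtain \<alpha>s where \<alpha>s: "\<alpha>s \<in> succs F s" "Max ?A = (\<Sum>j\<in>UNIV. weight F n (\<alpha>s j))" by blast
  have "weight F (Suc n) s = weight F n s \<or> weight F (Suc n) s = Max ?A"
    by (simp add: max_def)
  then show ?thesis
  proof
    assume "weight F (Suc n) s = Max ?A"
    with \<alpha>s show ?thesis by (intro that(2)) simp_all
  qed (rule that(1))
qed

section \<open>Monotonicity of the recursive counts and inheritance of essentiality\<close>

lemma prod_rec_count_le:
  "\<alpha>s \<in> succs F s \<Longrightarrow> (\<Prod>j\<in>UNIV. rec_count F n (\<alpha>s j)) \<le> rec_count F (Suc n) s"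
  unfolding rec_count_Suc by (rule member_le_sum) auto

lemma rec_count_ge_1: "rec_count F n s \<ge> 1"
proof (induction n arbitrary: s)
  case (Suc n)
  obtain \<alpha>s where \<alpha>s: "\<alpha>s \<in> succs F s" using succs_nonempty by blast
  have "1 \<le> (\<Prod>j\<in>UNIV. rec_count F n (\<alpha>s j))" using Suc by (intro prod_ge_1) auto
  then show ?case using prod_rec_count_le[OF \<alpha>s] order_trans by blast
qed simp

lemma rec_count_inessential:
  assumes "\<not> essential F s"
  shows "rec_count F n s = 1"
proof (cases n)
  case (Suc k)
  then have "\<not> rec_count F n s \<ge> 2" using assms by (auto simp: essential_def)
  then show ?thesis using rec_count_ge_1[of n s] by linarith
qed simp

lemma rec_count_mono: "m \<le> n \<Longrightarrow> rec_count F m s \<le> rec_count F n s"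
proof (rule lift_Suc_mono_le[of "\<lambda>n. rec_count F n s"])
  show "rec_count F n s \<le> rec_count F (Suc n) s" for n
  proof (induction n arbitrary: s)
    case 0
    show ?case using rec_count_ge_1[of 1 s] by simp
  next
    case (Suc n)
    have "(\<Sum>\<alpha>s\<in>succs F s. \<Prod>j\<in>UNIV. rec_count F n (\<alpha>s j)) \<le>
        (\<Sum>\<alpha>s\<in>succs F s. \<Prod>j\<in>UNIV. rec_count F (Suc n) (\<alpha>s j))"
      using Suc by (intro sum_mono prod_mono) auto
    then show ?case by (simp only: rec_count_Suc)
  qed
qed

lemma rec_count_child_le:
  assumes "\<alpha>s \<in> succs F s"
  shows "rec_count F n (\<alpha>s j) \<le> rec_count F (Suc n) s"
proof -
  have "rec_count F n (\<alpha>s j) dvd (\<Prod>j\<in>UNIV. rec_count F n (\<alpha>s j))" by (intro dvd_prodI) auto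
  moreover have "1 \<le> (\<Prod>j\<in>UNIV. rec_count F n (\<alpha>s j))"
    using rec_count_ge_1 by (intro prod_ge_1) auto
  ultimately have "rec_count F n (\<alpha>s j) \<le> (\<Prod>j\<in>UNIV. rec_count F n (\<alpha>s j))"
    by (metis dvd_imp_le less_le_trans zero_less_one)
  also have "\<dots> \<le> rec_count F (Suc n) s" using assms by (rule prod_rec_count_le)
  finally show ?thesis .
qed

text \<open>The count of a child is dominated by that of its parent one index later.
  Contrapositively, inessential nodes have only inessential descendants, so they never contribute
  weight.\<close>

lemma essential_parent:
  assumes "\<alpha>s \<in> succs F s" "essential F (\<alpha>s j)"
  shows "essential F s"
proof -
  obtain m where "rec_count F m (\<alpha>s j) \<ge> 2" using assms(2) by (auto simp: essential_def)
  then have "rec_count F (Suc m) s \<ge> 2" using rec_count_child_le[OF assms(1)] order_trans by blast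
  then show ?thesis unfolding essential_def by (intro exI[of _ "Suc m"]) simp
qed

text \<open>The counts increase with the index and the alphabet is finite, so the largest of the
  individual thresholds works.\<close>

lemma essential_threshold: "\<exists>m. \<forall>s. essential F s \<longrightarrow> 2 \<le> rec_count F m s"
proof -
  have "\<forall>s. \<exists>m. essential F s \<longrightarrow> 2 \<le> rec_count F m s" by (auto simp: essential_def)
  then obtain m where m: "\<And>s. essential F s \<Longrightarrow> 2 \<le> rec_count F (m s) s" by metis
  have "2 \<le> rec_count F (Max (range m)) s" if "essential F s" for s
    using m[OF that] rec_count_mono[of "m s" "Max (range m)" s] by simp
  then show ?thesis by blast
qed

section \<open>Submultiplicativity of the weights and their comparison with the counts\<close>

lemma weight_inessential: "\<not> essential F s \<Longrightarrow> weight F n s = 0"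
proof (induction n arbitrary: s)
  case (Suc n)
  show ?case
  proof (rule weight_Suc_cases[of n s])
    fix \<alpha>s assume "\<alpha>s \<in> succs F s" "weight F (Suc n) s = (\<Sum>j\<in>UNIV. weight F n (\<alpha>s j))"
    then show ?thesis using Suc essential_parent by (metis sum.neutral)
  qed (use Suc in simp)
qed simp

lemma weight_essential: "essential F s \<Longrightarrow> 1 \<le> weight F n s"
  by (induction n) auto

text \<open>Each essential node reached after \<open>n\<close> steps has at most
  \<open>max_weight F m\<close> essential descendants on a level \<open>m\<close> further down, and
  inessential nodes have none.\<close>

lemma weight_add_le: "weight F (n + m) s \<le> weight F n s * max_weight F m"
proof (induction n arbitrary: s)
  case 0
  show ?case
    using weight_inessential[of s m] weight_le_max_weight[of F m s] by (cases "essential F s") auto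
next
  case (Suc n)
  show ?case
  proof (rule weight_Suc_cases[of "n + m" s])
    assume "weight F (Suc (n + m)) s = weight F (n + m) s"
    also have "\<dots> \<le> weight F n s * max_weight F m" by (rule Suc)
    also have "\<dots> \<le> weight F (Suc n) s * max_weight F m" by (intro mult_right_mono) auto
    finally show ?thesis by simp
  next
    fix \<alpha>s assume \<alpha>s: "\<alpha>s \<in> succs F s"
      and "weight F (Suc (n + m)) s = (\<Sum>j\<in>UNIV. weight F (n + m) (\<alpha>s j))"
    note this(2)
    also have "(\<Sum>j\<in>UNIV. weight F (n + m) (\<alpha>s j)) \<le>
        (\<Sum>j\<in>UNIV. weight F n (\<alpha>s j)) * max_weight F m"
      unfolding sum_distrib_right by (intro sum_mono Suc)
    also have "\<dots> \<le> weight F (Suc n) s * max_weight F m"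
      using sum_weight_le_weight_Suc[OF \<alpha>s] by (rule mult_right_mono) simp
    finally show ?thesis by simp
  qed
qed

lemma max_weight_add_le: "max_weight F (n + m) \<le> max_weight F n * max_weight F m"
proof (rule max_weight_le)
  show "1 \<le> max_weight F n * max_weight F m"
    using max_weight_ge_1[of F n] max_weight_ge_1[of F m] by (simp add: Suc_le_eq)
  fix s
  show "weight F (n + m) s \<le> max_weight F n * max_weight F m"
    using weight_add_le[of n m s] mult_right_mono[OF weight_le_max_weight[of F n s], of "max_weight F m"]
    by linarith
qed

text \<open>Only essential nodes offer a choice. There are at most \<open>weight F n s\<close> of
  them on each of \<open>n\<close> levels, and each has at most
  \<open>CARD('d \<Rightarrow> 'a)\<close> child labellings.\<close>

lemma rec_count_le_power_weight:
  "rec_count F n s \<le> CARD('d \<Rightarrow> 'a) ^ (n * weight F n s)"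
proof (induction n arbitrary: s)
  case (Suc n)
  let ?K = "CARD('d \<Rightarrow> 'a)"
  have K: "?K \<ge> 1" by (simp add: Suc_le_eq)
  show ?case
  proof (cases "essential F s")
    case True
    have "(\<Prod>j\<in>UNIV. rec_count F n (\<alpha>s j)) \<le> ?K ^ (n * weight F (Suc n) s)"
      if "\<alpha>s \<in> succs F s" for \<alpha>s
    proof -
      have "(\<Prod>j\<in>UNIV. rec_count F n (\<alpha>s j)) \<le> (\<Prod>j\<in>UNIV. ?K ^ (n * weight F n (\<alpha>s j)))"
        using Suc by (intro prod_mono) auto
      also have "\<dots> = ?K ^ (n * (\<Sum>j\<in>UNIV. weight F n (\<alpha>s j)))"
        by (simp only: power_sum sum_distrib_left)
      also have "\<dots> \<le> ?K ^ (n * weight F (Suc n) s)"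
        using sum_weight_le_weight_Suc[OF that] K by (intro power_increasing mult_left_mono) auto
      finally show ?thesis .
    qed
    then have "rec_count F (Suc n) s \<le> card (succs F s) * ?K ^ (n * weight F (Suc n) s)"
      unfolding rec_count_Suc by (metis (no_types, lifting) of_nat_id sum_bounded_above)
    also have "\<dots> \<le> ?K * ?K ^ (n * weight F (Suc n) s)"
      by (intro mult_right_mono card_mono) auto
    also have "\<dots> = ?K ^ (1 + n * weight F (Suc n) s)" by simp
    \<comment> \<open>An essential root has weight at least 1, which absorbs the factor for the
      choice of its children.\<close>
    also have "\<dots> \<le> ?K ^ (Suc n * weight F (Suc n) s)"
      using K weight_essential[OF True, of "Suc n"] by (intro power_increasing) auto
    finally show ?thesis .
  next
    case False
    then show ?thesis using rec_count_inessential[OF False, of "Suc n"] K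
      by (simp del: rec_count.simps)
  qed
qed simp

text \<open>On a level with the most essential nodes, \<open>m\<close> further steps let each of
  them contribute an independent factor of at least 2.\<close>

lemma power_weight_le_rec_count:
  assumes m: "\<And>s. essential F s \<Longrightarrow> 2 \<le> rec_count F m s"
  shows "2 ^ weight F n s \<le> rec_count F (n + m) s"
proof (induction n arbitrary: s)
  case 0
  then show ?case using m rec_count_ge_1[of m s] by simp
next
  case (Suc n)
  show ?case
  proof (rule weight_Suc_cases[of n s])
    assume "weight F (Suc n) s = weight F n s"
    then show ?thesis using Suc[of s] rec_count_mono[of "n + m" "Suc n + m" s] by simp
  next
    fix \<alpha>s assume \<alpha>s: "\<alpha>s \<in> succs F s"
      and eq: "weight F (Suc n) s = (\<Sum>j\<in>UNIV. weight F n (\<alpha>s j))"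
    have "(2::nat) ^ weight F (Suc n) s = (\<Prod>j\<in>UNIV. 2 ^ weight F n (\<alpha>s j))"
      unfolding eq by (simp only: power_sum)
    also have "\<dots> \<le> (\<Prod>j\<in>UNIV. rec_count F (n + m) (\<alpha>s j))"
      using Suc by (intro prod_mono) auto
    also have "\<dots> \<le> rec_count F (Suc (n + m)) s" using \<alpha>s by (rule prod_rec_count_le)
    finally show ?thesis by simp
  qed
qed

section \<open>Entropy as the growth rate of the weights\<close>

text \<open>The block count lies between exponentials of the weights. Two logarithms turn the
  different bases, the extra factor \<open>n\<close> in the exponent and the index shift
  \<open>m\<close> into errors that vanish after division by \<open>n\<close>.\<close>

lemma entropy_eq_growth_rate:
  assumes card: "CARD('a) \<ge> 2"
    and lim: "(\<lambda>n. ln (real (max_weight F n)) / real n) \<longlonglongrightarrow> r"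
  shows "entropy (tree_shift F) = r"
proof -
  let ?P = "\<lambda>n. real (max_weight F n)"
  let ?K = "CARD('d \<Rightarrow> 'a)"
  let ?f = "\<lambda>n. ln (ln (real (card (occurring_blocks n (tree_shift F))))) / real n"
  define B where "B n = (\<Sum>s\<in>UNIV. rec_count F n s)" for n
  obtain m where m: "\<And>s. essential F s \<Longrightarrow> 2 \<le> rec_count F m s" using essential_threshold by blast
  have P1: "1 \<le> ?P n" for n using max_weight_ge_1[of F n] by simp
  \<comment> \<open>This lets the sum over all roots be absorbed into one more factor
    \<open>?K\<close>.\<close>
  have "CARD('a) ^ 1 \<le> CARD('a) ^ CARD('d)"
    using card by (intro power_increasing) (auto simp: Suc_le_eq)
  then have AK: "CARD('a) \<le> ?K" by (simp add: card_fun)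
  then have K: "2 \<le> ?K" using card by linarith
  have upper: "B n \<le> ?K ^ (2 * Suc n * max_weight F (Suc n))" for n
  proof -
    have "rec_count F n s \<le> ?K ^ (n * max_weight F n)" for s
    proof -
      have "?K ^ (n * weight F n s) \<le> ?K ^ (n * max_weight F n)"
        using K weight_le_max_weight by (intro power_increasing mult_left_mono) auto
      then show ?thesis using rec_count_le_power_weight[of n s] by linarith
    qed
    then have "B n \<le> CARD('a) * ?K ^ (n * max_weight F n)"
      unfolding B_def by (metis (no_types, lifting) of_nat_id sum_bounded_above)
    also have "\<dots> \<le> ?K * ?K ^ (n * max_weight F n)" using AK by (rule mult_right_mono) simp
    also have "\<dots> = ?K ^ (1 + n * max_weight F n)" by simp
    also have "\<dots> \<le> ?K ^ (2 * Suc n * max_weight F (Suc n))"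
    proof (rule power_increasing)
      have "1 + n * max_weight F n \<le> max_weight F (Suc n) + n * max_weight F (Suc n)"
        using max_weight_ge_1[of F "Suc n"] max_weight_mono[of F n] by (intro add_mono) auto
      then show "1 + n * max_weight F n \<le> 2 * Suc n * max_weight F (Suc n)" by simp
    qed (use K in simp)
    finally show ?thesis .
  qed
  have lower: "2 ^ max_weight F n \<le> B (n + m)" for n
  proof -
    \<comment> \<open>This covers the case in which \<open>max_weight\<close> takes its cutoff value
      1: two possible roots already give two blocks.\<close>
    have B2: "2 \<le> B (n + m)"
    proof -
      have "(\<Sum>s\<in>(UNIV::'a set). 1) \<le> B (n + m)"
        unfolding B_def using rec_count_ge_1 by (intro sum_mono) auto
      then show ?thesis using card by simp
    qed
    have "Max (range (weight F n)) \<in> range (weight F n)" by (rule Max_in) auto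
    then obtain s where s: "Max (range (weight F n)) = weight F n s" by blast
    have "2 ^ weight F n s \<le> rec_count F (n + m) s"
      using m by (rule power_weight_le_rec_count)
    also have "\<dots> \<le> B (n + m)" unfolding B_def by (rule member_le_sum) auto
    finally show ?thesis using B2 s by (simp add: max_weight_def max_def)
  qed
  \<comment> \<open>\<open>a\<close> collects the base 2 and the loss from index
    \<open>Suc n\<close> down to \<open>n - m\<close>; \<open>b\<close> collects the constant
    factors of the upper exponent.\<close>
  define a where "a = ln (ln 2) - ln (?P (Suc m))"
  define b where "b = ln (2 * ln (real ?K))"
  have lnK: "0 < ln (real ?K)" using K by simp
  have bounds: "(a + ln (?P (Suc n))) / real (Suc n) \<le> ?f (Suc n) \<and>
      ?f (Suc n) \<le> (b + ln (real (Suc n)) + ln (?P (Suc n))) / real (Suc n)" if "n \<ge> m" for n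
  proof -
    have low: "2 ^ max_weight F (n - m) \<le> B n" using lower[of "n - m"] that by simp
    then have "real (2 ^ max_weight F (n - m)) \<le> real (B n)" by (simp only: of_nat_le_iff)
    then have "ln (2 ^ max_weight F (n - m)) \<le> ln (real (B n))" by (intro ln_mono) auto
    then have l1: "?P (n - m) * ln 2 \<le> ln (real (B n))" by (simp add: ln_realpow)
    have pos: "0 < ?P (n - m) * ln 2" using P1[of "n - m"] by (intro mult_pos_pos) auto
    have Bpos: "0 < B n" using low by (metis gr0I le_zero_eq power_eq_0_iff zero_neq_numeral)
    have "real (B n) \<le> real (?K ^ (2 * Suc n * max_weight F (Suc n)))"
      using upper by (simp only: of_nat_le_iff)
    then have "ln (real (B n)) \<le> ln (real ?K ^ (2 * Suc n * max_weight F (Suc n)))"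
      using Bpos by (intro ln_mono) auto
    also have "\<dots> = real (2 * Suc n * max_weight F (Suc n)) * ln (real ?K)"
      using K by (subst ln_realpow) auto
    also have "\<dots> = (2 * ln (real ?K)) * real (Suc n) * ?P (Suc n)" by (simp add: algebra_simps)
    finally have "ln (ln (real (B n))) \<le> ln ((2 * ln (real ?K)) * real (Suc n) * ?P (Suc n))"
      using l1 pos by (intro ln_mono) auto
    also have "\<dots> = b + ln (real (Suc n)) + ln (?P (Suc n))"
      using lnK P1[of "Suc n"] unfolding b_def by (subst ln_mult_pos | simp)+
    finally have u: "ln (ln (real (B n))) \<le> b + ln (real (Suc n)) + ln (?P (Suc n))" .
    \<comment> \<open>The lower bound speaks of index \<open>n - m\<close>; submultiplicativity
      returns to \<open>Suc n\<close> at the cost of a constant factor.\<close>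
    have "max_weight F (Suc n) \<le> max_weight F (n - m) * max_weight F (Suc m)"
      using max_weight_add_le[of "n - m" "Suc m"] that by simp
    then have "?P (Suc n) \<le> ?P (n - m) * ?P (Suc m)" by (metis of_nat_le_iff of_nat_mult)
    then have "ln (?P (Suc n)) \<le> ln (?P (n - m) * ?P (Suc m))"
      using P1[of "Suc n"] by (intro ln_mono) auto
    also have "\<dots> = ln (?P (n - m)) + ln (?P (Suc m))"
      using P1[of "n - m"] P1[of "Suc m"] by (subst ln_mult_pos) auto
    finally have "a + ln (?P (Suc n)) \<le> ln (?P (n - m)) + ln (ln 2)" unfolding a_def by simp
    also have "\<dots> = ln (?P (n - m) * ln 2)" using P1[of "n - m"] by (subst ln_mult_pos) auto
    also have "\<dots> \<le> ln (ln (real (B n)))" using l1 pos by (intro ln_mono) auto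
    finally have "a + ln (?P (Suc n)) \<le> ln (ln (real (B n)))" .
    with u show ?thesis unfolding card_occurring_blocks B_def[symmetric]
      by (intro conjI divide_right_mono) auto
  qed
  have lim': "(\<lambda>n. ln (?P (Suc n)) / real (Suc n)) \<longlonglongrightarrow> r"
    using LIMSEQ_Suc[OF lim] .
  have const: "(\<lambda>n. c / real (Suc n)) \<longlonglongrightarrow> 0" for c :: real
    using LIMSEQ_Suc[OF lim_const_over_n[of c]] .
  have log: "(\<lambda>n. ln (real (Suc n)) / real (Suc n)) \<longlonglongrightarrow> 0"
    using LIMSEQ_Suc[OF filterlim_compose[OF ln_x_over_x_tendsto_0 filterlim_real_sequentially]] .
  have lo: "(\<lambda>n. (a + ln (?P (Suc n))) / real (Suc n)) \<longlonglongrightarrow> r"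
    using tendsto_add[OF const[of a] lim'] by (simp add: add_divide_distrib)
  have up: "(\<lambda>n. (b + ln (real (Suc n)) + ln (?P (Suc n))) / real (Suc n)) \<longlonglongrightarrow> r"
    using tendsto_add[OF tendsto_add[OF const[of b] log] lim'] by (simp add: add_divide_distrib)
  have ev: "\<forall>\<^sub>F n in sequentially. (a + ln (?P (Suc n))) / real (Suc n) \<le> ?f (Suc n)"
    "\<forall>\<^sub>F n in sequentially. ?f (Suc n) \<le> (b + ln (real (Suc n)) + ln (?P (Suc n))) / real (Suc n)"
    using bounds unfolding eventually_sequentially by blast+
  have "(\<lambda>n. ?f (Suc n)) \<longlonglongrightarrow> r" by (rule tendsto_sandwich[OF ev lo up])
  then have "?f \<longlonglongrightarrow> r" by (rule LIMSEQ_imp_Suc)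
  then show ?thesis unfolding entropy_def by (rule limI)
qed

text \<open>Submultiplicativity of \<open>max_weight\<close> becomes subadditivity of its logarithm.
  Fekete's lemma then gives both the existence of the growth rate and its bound by the quotient at
  \<open>n = 1\<close>.\<close>

lemma entropy_le_ln_max_weight_1:
  assumes "CARD('a) \<ge> 2"
  shows "entropy (tree_shift F) \<le> ln (real (max_weight F 1))"
proof -
  let ?p = "\<lambda>n. ln (real (max_weight F n))"
  have P1: "1 \<le> real (max_weight F n)" for n using max_weight_ge_1[of F n] by simp
  have sub: "?p (m + n) \<le> ?p m + ?p n" for m n
  proof -
    have "real (max_weight F (m + n)) \<le> real (max_weight F m) * real (max_weight F n)"
      using max_weight_add_le[of m n] by (metis of_nat_le_iff of_nat_mult)
    then have "?p (m + n) \<le> ln (real (max_weight F m) * real (max_weight F n))"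
      using P1[of "m + n"] by (intro ln_mono) auto
    also have "\<dots> = ?p m + ?p n" using P1[of m] P1[of n] by (subst ln_mult_pos) auto
    finally show ?thesis .
  qed
  have nonneg: "0 \<le> ?p n" for n using P1 by simp
  obtain l where l: "(\<lambda>n. ?p n / real n) \<longlonglongrightarrow> l" "\<And>n. n \<ge> 1 \<Longrightarrow> l \<le> ?p n / real n"
    using subadditive_limit[of ?p, OF sub nonneg] by blast
  have "entropy (tree_shift F) = l" using assms l(1) by (rule entropy_eq_growth_rate)
  then show ?thesis using l(2)[of 1] by simp
qed

text \<open>Here the weight is the full number of nodes on level \<open>n\<close>, whatever
  labelling is chosen, so the growth rate is explicit.\<close>

lemma entropy_all_essential:
  assumes "CARD('a) \<ge> 2" and ess: "\<And>s. essential F s"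
  shows "entropy (tree_shift F) = ln (real CARD('d))"
proof -
  have w: "weight F n s = CARD('d) ^ n" for n s
  proof (induction n arbitrary: s)
    case (Suc n)
    have "(\<lambda>\<alpha>s. \<Sum>j\<in>(UNIV::'d set). CARD('d) ^ n) ` succs F s = {CARD('d) ^ Suc n}"
      using succs_nonempty[of s] by auto
    moreover have "CARD('d) ^ n \<le> CARD('d) ^ Suc n"
      by (intro power_increasing) (auto simp: Suc_le_eq)
    ultimately show ?case using Suc by simp
  qed (simp add: ess)
  have "max_weight F n = CARD('d) ^ n" for n
  proof -
    have "range (weight F n) = {CARD('d) ^ n}" using w by auto
    then show ?thesis by (simp add: max_weight_def max_def)
  qed
  then have eq: "ln (real (max_weight F n)) / real n = ln (real CARD('d))" if "n \<ge> 1" for n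
    using that by (simp add: ln_realpow)
  have "(\<lambda>n. ln (real (max_weight F n)) / real n) \<longlonglongrightarrow> ln (real CARD('d))"
    by (rule tendsto_eventually) (use eq in \<open>auto simp: eventually_sequentially\<close>)
  then show ?thesis by (rule entropy_eq_growth_rate[OF assms(1)])
qed

text \<open>A single level suffices: an essential node is not labelled \<open>a\<close>, hence one
  of its children is, and that child has weight 0.\<close>

lemma entropy_inessential_saving:
  assumes card: "CARD('a) \<ge> 2" and d: "CARD('d) \<ge> 2"
    and saving: "saving_symbol F a" and iness: "\<not> essential F a"
  shows "entropy (tree_shift F) < ln (real CARD('d))"
proof -
  have "max_weight F 1 \<le> CARD('d) - 1"
  proof (rule max_weight_le)
    fix s
    show "weight F 1 s \<le> CARD('d) - 1"
    proof (cases "essential F s")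
      case True
      then have "s \<noteq> a" using iness by blast
      show ?thesis
      proof (rule weight_Suc_cases[of 0 s])
        \<comment> \<open>The root alone has weight at most 1, which is at most
          \<open>CARD('d) - 1\<close> as there are at least two children.\<close>
        assume "weight F (Suc 0) s = weight F 0 s"
        then show ?thesis using d by (simp del: weight.simps(2)) linarith
      next
        fix \<alpha>s assume \<alpha>s: "\<alpha>s \<in> succs F s"
          and eq: "weight F (Suc 0) s = (\<Sum>j\<in>UNIV. weight F 0 (\<alpha>s j))"
        obtain i where i: "\<alpha>s i = a"
          using saving \<alpha>s \<open>s \<noteq> a\<close> by (auto simp: saving_symbol_def succs_def)
        have "(\<Sum>j\<in>UNIV. weight F 0 (\<alpha>s j)) = (\<Sum>j\<in>UNIV - {i}. weight F 0 (\<alpha>s j))"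
          using i iness by (intro sum.mono_neutral_right) auto
        also have "\<dots> \<le> (\<Sum>j\<in>UNIV - {i}. 1)" by (intro sum_mono) auto
        also have "\<dots> = CARD('d) - 1" by (simp add: card_Diff_singleton)
        finally show ?thesis using eq by simp
      qed
    next
      case False
      then show ?thesis using weight_inessential[of s 1] by linarith
    qed
  qed (use d in simp)
  then have "ln (real (max_weight F 1)) < ln (real CARD('d))"
    using d max_weight_ge_1[of F 1] by (intro ln_strict_mono | simp)+
  then show ?thesis using entropy_le_ln_max_weight_1[OF card] by linarith
qed

text \<open>Any other symbol has an allowed child labelling, which must contain \<open>a\<close>,
  and essentiality passes from child to parent.\<close>

lemma all_essential_if_saving_essential:
  assumes "saving_symbol F a" "essential F a"
  shows "essential F s"
proof (cases "s = a")
  case False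
  obtain \<alpha>s where \<alpha>s: "\<alpha>s \<in> succs F s" using succs_nonempty by blast
  then obtain i where "\<alpha>s i = a" using assms(1) False by (auto simp: saving_symbol_def succs_def)
  then show ?thesis using essential_parent[OF \<alpha>s, of i] assms(2) by simp
qed (use assms in simp)

end

theorem proposition2p10:
  fixes F F' :: "('d::finite, 'a::finite) block set" and a :: 'a
  assumes "CARD('d) \<ge> 2"
    and "F \<subseteq> n_blocks 2" and "F' \<subseteq> n_blocks 2"
    and "\<forall>s. essential F s"
    and "saving_symbol F a"
    and "tree_shift F' \<subset> tree_shift F"
    and "F \<subset> F'" and "card (F' - F) = 1"
    and "\<forall>s. \<exists>t\<in>tree_shift F'. s \<in> range t"
  shows "entropy (tree_shift F') < entropy (tree_shift F) \<longleftrightarrow> inessential F' a"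
proof -
  \<comment> \<open>A tree of the smaller shift showing a given symbol is also a tree of the larger
    one.\<close>
  interpret X: markov_tree_shift F
    using assms(2,6,9) by unfold_locales blast+
  interpret Y: markov_tree_shift F'
    using assms(3,9) by unfold_locales blast+
  \<comment> \<open>Over a one-letter alphabet there is only one tree, so a nonempty subshift could
    not be proper.\<close>
  have card: "CARD('a) \<ge> 2"
  proof (rule ccontr)
    assume "\<not> CARD('a) \<ge> 2"
    then have "CARD('a) \<le> Suc 0" by simp
    then have "x = y" for x y :: 'a by (simp add: card_le_Suc0_iff_eq)
    then have "t = t'" for t t' :: "('d, 'a) inf_tree" by blast
    moreover obtain t where "t \<in> tree_shift F'" using assms(9) by blast
    ultimately show False using assms(6) by (metis psubsetE subsetI)
  qed
  \<comment> \<open>Forbidding more blocks leaves fewer on which the saving condition has to be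
    checked.\<close>
  have saving: "saving_symbol F' a"
    using assms(5,7) by (auto simp: saving_symbol_def)
  have X: "entropy (tree_shift F) = ln (real CARD('d))"
    using card assms(4) by (intro X.entropy_all_essential) auto
  show ?thesis
  proof
    \<comment> \<open>By contraposition: if \<open>a\<close> were essential for \<open>F'\<close>,
      all symbols would be, and both entropies would equal
      \<open>ln (real CARD('d))\<close>.\<close>
    assume "entropy (tree_shift F') < entropy (tree_shift F)"
    then show "inessential F' a"
      using X Y.entropy_all_essential[OF card] Y.all_essential_if_saving_essential[OF saving]
      unfolding inessential_def by force
  next
    assume "inessential F' a"
    then show "entropy (tree_shift F') < entropy (tree_shift F)"
      using X Y.entropy_inessential_saving[OF card assms(1) saving] by (simp add: inessential_def)
  qed
qed

end
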